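(* Let $0<s<1$ and let $\Omega$ be a bounded narrow region in $\mathbb{R}^n$. Assume that $w_\tau\in\mathcal{L}_{2s}\cap C^2(\Omega)$ is upper semi-continuous on $\overline{\Omega}$ and satisfies $$\begin{cases}(-\Delta)^s w_\tau(x)-\Delta w_\tau(x)+c(x)w_\tau(x)\le 0, & x\in\Omega,\\ w_\tau(x)\le 0, & x\in\Omega^c:=\mathbb{R}^n\setminus\Omega,\end{cases}$$ where $c(x)$ is bounded from below in $\Omega$. Let $l_n(\Omega)$ denote the width of $\Omega$ in the $x_n$-direction, and assume that $\Omega$ is narrow in this direction in the sense that $$l_n(\Omega)\,\Big|\inf_{\Omega} c(x)\Big|^{\frac{1}{2s}}\le C,$$ where $C$ is a positive constant. Then $$w_\tau(x)\le 0,\quad x\in\Omega.$$ Furthermore, either $w_\tau(x)<0$ for $x\in\Omega$, or $w_\tau(x)\equiv 0$ for $x\in\mathbb{R}^n$.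
   Context: Points of $\mathbb{R}^n$ are written $x=(x',x_n)$ with $x'\in\mathbb{R}^{n-1}$. The width of $\Omega$ in the $x_n$-direction is $l_n(\Omega)=\sup\{x_n-y_n : x,y\in\Omega\}$. The subscript $\tau$ comes from the sliding method, where for a function $u$ and $\tau>0$ one sets $w_\tau(x)=u(x)-u(x',x_n+\tau)$; the theorem is stated in terms of the listed properties of the function $w_\tau$ only. The space $\mathcal{L}_{2s}$ is $$\mathcal{L}_{2s}=\Big\{u\in L^1_{loc}(\mathbb{R}^n)\ \Big|\ \int_{\mathbb{R}^n}\frac{|u(x)|}{1+|x|^{n+2s}}\,dx<+\infty\Big\}.$$ The fractional Laplacian is $$(-\Delta)^s u(x)=C_{n,s}\,\mathrm{P.V.}\int_{\mathbb{R}^n}\frac{u(x)-u(y)}{|x-y|^{n+2s}}\,dy=C_{n,s}\lim_{\epsilon\to0}\int_{\mathbb{R}^n\setminus B_\epsilon(x)}\frac{u(x)-u(y)}{|x-y|^{n+2s}}\,dy,$$ where P.V. stands for the Cauchy principal value and $C_{n,s}>0$ is a normalization constant. $\Delta$ is the classical Laplacian.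
   Formalization: The alternative "w ≡ 0 in R^n" is stated as w = 0 at every point of the closure of Ω and almost everywhere in R^n, since changing w to −1 at one point outside the closure of Ω refutes the pointwise claim; C is a constant depending only on n, s and C_{n,s}. *)

theory Defs
  imports "HOL-Analysis.Analysis"
begin

text \<open>The space \<open>L\<^sub>2\<^sub>s\<close>. Integrability of the weighted function is finiteness of the defining
  integral, because local integrability already makes \<open>u\<close> Lebesgue measurable.\<close>

definition locally_integrable :: "(real ^ 'n \<Rightarrow> real) \<Rightarrow> bool" where
  "locally_integrable u \<longleftrightarrow> (\<forall>K. compact K \<longrightarrow> set_integrable lebesgue K u)"

definition L2s_space :: "real \<Rightarrow> (real ^ 'n \<Rightarrow> real) set" where
  "L2s_space s = {u. locally_integrable u \<and>
     integrable lebesgue (\<lambda>x. \<bar>u x\<bar> / (1 + norm x powr (real CARD('n) + 2 * s)))}"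

text \<open>The argument \<open>\<kappa>\<close> is the normalization constant \<open>C\<^sub>n\<^sub>,\<^sub>s\<close>. The limit
  exists at every point near which \<open>u\<close> is twice continuously differentiable, if \<open>u\<close> lies in
  \<^term>\<open>L2s_space s\<close> and \<open>0 < s < 1\<close>; elsewhere the value may be arbitrary.\<close>

definition fractional_laplacian :: "real \<Rightarrow> real \<Rightarrow> (real ^ 'n \<Rightarrow> real) \<Rightarrow> real ^ 'n \<Rightarrow> real" where
  "fractional_laplacian \<kappa> s u x =
     \<kappa> * Lim (at_right 0) (\<lambda>\<epsilon>. LINT y:(UNIV - ball x \<epsilon>)|lebesgue.
            (u x - u y) / norm (x - y) powr (real CARD('n) + 2 * s))"

definition partial_derivative :: "'n \<Rightarrow> (real ^ 'n \<Rightarrow> real) \<Rightarrow> real ^ 'n \<Rightarrow> real" where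
  "partial_derivative i u x = deriv (\<lambda>t. u (x + t *\<^sub>R axis i 1)) 0"

definition laplacian :: "(real ^ 'n \<Rightarrow> real) \<Rightarrow> real ^ 'n \<Rightarrow> real" where
  "laplacian u x = (\<Sum>i\<in>UNIV. partial_derivative i (partial_derivative i u) x)"

text \<open>Twice continuously Frechet differentiable on \<open>S\<close>; to be used for open \<open>S\<close>.\<close>

definition C2_on :: "(real ^ 'n) set \<Rightarrow> (real ^ 'n \<Rightarrow> real) \<Rightarrow> bool" where
  "C2_on S u \<longleftrightarrow>
     (\<exists>(u' :: real ^ 'n \<Rightarrow> (real ^ 'n) \<Rightarrow>\<^sub>L real)
       (u'' :: real ^ 'n \<Rightarrow> (real ^ 'n) \<Rightarrow>\<^sub>L ((real ^ 'n) \<Rightarrow>\<^sub>L real)).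
        (\<forall>x\<in>S. (u has_derivative blinfun_apply (u' x)) (at x)) \<and>
        (\<forall>x\<in>S. (u' has_derivative blinfun_apply (u'' x)) (at x)) \<and>
        continuous_on S u'')"

definition upper_semicontinuous_on :: "'a::topological_space set \<Rightarrow> ('a \<Rightarrow> real) \<Rightarrow> bool" where
  "upper_semicontinuous_on S u \<longleftrightarrow>
     (\<forall>x\<in>S. \<forall>e>0. \<forall>\<^sub>F y in at x within S. u y < u x + e)"

definition width :: "'n \<Rightarrow> (real ^ 'n) set \<Rightarrow> real" where
  "width k S = Sup {x $ k - y $ k | x y. x \<in> S \<and> y \<in> S}"

end

theory Submission
  imports Defs
begin

text \<open>Suppose that \<open>w\<close> is positive somewhere. It is nonpositive outside \<open>\<Omega>\<close> and upper
  semicontinuous on the compact closure, so it attains a positive global maximum at a point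
  \<open>x\<^sub>0\<close> of \<open>\<Omega>\<close>. There the classical Laplacian is nonpositive. In the fractional Laplacian the
  integrand \<open>(w x\<^sub>0 - w y) / norm (x\<^sub>0 - y) powr (n + 2 * s)\<close> is nonnegative everywhere, and it is
  bounded below on a ball of radius \<open>l = width k \<Omega>\<close> that lies beside \<open>\<Omega>\<close> in direction
  \<open>k\<close>, at distance comparable to \<open>l\<close> from \<open>x\<^sub>0\<close>. This yields
  \<open>A * w x\<^sub>0 / l powr (2 * s)\<close> as a lower bound for the fractional Laplacian
  (\<open>fractional_laplacian_ge_at_positive_max\<close>), where \<open>A\<close> depends only on the dimension, \<open>s\<close> and
  \<open>\<kappa>\<close>. The differential inequality then forces \<open>c x\<^sub>0 \<le> - A / l powr (2 * s)\<close>, which a narrow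
  region excludes (\<open>maximum_principle_narrow\<close>).

  If moreover \<open>w\<close> vanishes at a point of \<open>\<Omega>\<close>, that point is again a global maximum, the
  zero-order term vanishes there, and the inequality leaves no room: the integral of the
  nonnegative integrand is zero, so \<open>w = 0\<close> almost everywhere (\<open>strong_maximum_principle\<close>).
  Continuity extends this to all of \<open>\<Omega>\<close>, and upper semicontinuity to the boundary.

  The analytic core is \<open>fractional_laplacian_at_global_max\<close>: at a global maximum where \<open>w\<close> is
  twice continuously differentiable, the principal value exists and equals an absolutely convergent
  integral. It rests on the integrability of powers of the distance, near the centre and at
  infinity, which follows from a dyadic decomposition.\<close>

section \<open>Maxima of upper semicontinuous functions\<close>

text \<open>If no point were maximal, every \<open>x\<close> would be beaten by some \<open>h x\<close>, and by upper
  semicontinuity \<open>h x\<close> would beat a whole neighbourhood of \<open>x\<close>. Finitely many of these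
  neighbourhoods cover the compact set, so the best of finitely many values \<open>u (h x)\<close> would beat
  itself.\<close>

lemma upper_semicontinuous_on_attains_sup:
  fixes u :: "'a::topological_space \<Rightarrow> real"
  assumes "compact K" "K \<noteq> {}" "upper_semicontinuous_on K u"
  obtains x where "x \<in> K" "\<forall>y\<in>K. u y \<le> u x"
proof -
  have "\<exists>x\<in>K. \<forall>y\<in>K. u y \<le> u x"
  proof (rule ccontr)
    assume "\<not> ?thesis"
    then obtain h where h: "\<And>x. x \<in> K \<Longrightarrow> h x \<in> K \<and> u x < u (h x)"
      by (metis not_le)
    have "\<exists>U. open U \<and> x \<in> U \<and> (\<forall>y\<in>U \<inter> K. u y < u (h x))" if "x \<in> K" for x
    proof -
      have "\<forall>\<^sub>F y in at x within K. u y < u x + (u (h x) - u x)"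
        using assms(3) that h[OF that] unfolding upper_semicontinuous_on_def
        by (metis diff_gt_0_iff_gt)
      then obtain U where "open U" "x \<in> U" "\<forall>y\<in>U. y \<noteq> x \<longrightarrow> y \<in> K \<longrightarrow> u y < u (h x)"
        by (auto simp: eventually_at_topological)
      then show ?thesis using h[OF that] by (intro exI[of _ U]) auto
    qed
    then obtain U where U: "\<And>x. x \<in> K \<Longrightarrow> open (U x) \<and> x \<in> U x \<and> (\<forall>y\<in>U x \<inter> K. u y < u (h x))"
      by metis
    obtain F where F: "F \<subseteq> K" "finite F" "K \<subseteq> (\<Union>x\<in>F. U x)"
      using compactE_image[OF assms(1), of K U] U by blast
    have "F \<noteq> {}" using F assms(2) by auto
    define m where "m = Max ((\<lambda>x. u (h x)) ` F)"
    have "m \<in> (\<lambda>x. u (h x)) ` F" unfolding m_def using F(2) \<open>F \<noteq> {}\<close> by (intro Max_in) auto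
    then obtain x where x: "x \<in> F" "m = u (h x)" by blast
    have x_max: "u (h z) \<le> u (h x)" if "z \<in> F" for z
      unfolding x(2)[symmetric] m_def using F(2) that by simp
    have "h x \<in> K" using h F x(1) by blast
    then obtain z where "z \<in> F" "h x \<in> U z" using F by blast
    then have "u (h x) < u (h z)" using U F \<open>h x \<in> K\<close> by blast
    then show False using x_max[OF \<open>z \<in> F\<close>] by simp
  qed
  then show ?thesis using that by blast
qed

section \<open>Integrability of radial powers\<close>

text \<open>On the annulus of radius \<open>\<rho> = r * b ^ j\<close> the power \<open>\<rho> powr (-p)\<close> times the volume of
  order \<open>\<rho> ^ n\<close> is a constant times the \<open>j\<close>-th power of \<open>b powr (n - p)\<close>, so the
  annuli contribute a convergent geometric series. The base \<open>b = 2\<close> exhausts a neighbourhood of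
  infinity and \<open>b = 1/2\<close> a punctured neighbourhood of the centre, which gives both classical
  integrability criteria at once.\<close>

lemma integrable_radial_power_on_annuli:
  fixes x\<^sub>0 :: "'a::euclidean_space"
  assumes r: "0 < r" and b: "0 < b" and q: "b powr (real DIM('a) - p) < 1"
  shows "set_integrable lebesgue
     (\<Union>j. {y. r * b ^ j \<le> norm (x\<^sub>0 - y) \<and> norm (x\<^sub>0 - y) \<le> 2 * (r * b ^ j)})
     (\<lambda>y. 1 / norm (x\<^sub>0 - y) powr p)"
proof -
  let ?n = "DIM('a)"
  define A where "A j = {y. r * b ^ j \<le> norm (x\<^sub>0 - y) \<and> norm (x\<^sub>0 - y) \<le> 2 * (r * b ^ j)}" for j :: nat
  define f where "f y = 1 / norm (x\<^sub>0 - y) powr p" for y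
  \<comment> \<open>The power is largest at the inner or at the outer radius of an annulus, depending on the sign
    of the exponent; \<open>M\<close> covers both cases.\<close>
  define M where "M = max 1 (2 powr (-p))"
  define D where "D = M * r powr (-p) * (unit_ball_vol ?n * (2 * r) ^ ?n)"
  have [measurable]: "f \<in> borel_measurable borel" unfolding f_def by measurable
  have "closed (A j)" for j unfolding A_def
    by (intro closed_Collect_conj closed_Collect_le continuous_intros)
  then have [measurable]: "A j \<in> sets borel" for j by simp
  have M: "1 \<le> M" "2 powr (-p) \<le> M" by (auto simp: M_def)
  have ring: "(\<integral>\<^sup>+y. ennreal (indicator (A j) y * f y) \<partial>lborel) \<le> ennreal (D * (b powr (?n - p)) ^ j)" for j
  proof -
    define \<rho> where "\<rho> = r * b ^ j"
    have \<rho>: "0 < \<rho>" using r b by (simp add: \<rho>_def)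
    have pw: "indicator (A j) y * f y \<le> M * \<rho> powr (-p) * indicator (cball x\<^sub>0 (2*\<rho>)) y" for y
    proof (cases "y \<in> A j")
      case True
      then have a: "\<rho> \<le> norm (x\<^sub>0 - y)" "norm (x\<^sub>0 - y) \<le> 2 * \<rho>" by (auto simp: A_def \<rho>_def)
      have "f y = norm (x\<^sub>0 - y) powr (-p)" by (simp add: f_def powr_minus_divide)
      also have "\<dots> \<le> M * \<rho> powr (-p)"
      proof (cases "0 \<le> p")
        case True
        then have "norm (x\<^sub>0 - y) powr (-p) \<le> \<rho> powr (-p)"
          using a \<rho> by (intro powr_mono2') auto
        also have "\<dots> \<le> M * \<rho> powr (-p)" using M by (simp add: mult_le_cancel_right1)
        finally show ?thesis .
      next
        case False
        then have "norm (x\<^sub>0 - y) powr (-p) \<le> (2 * \<rho>) powr (-p)"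
          using a \<rho> by (intro powr_mono2) auto
        also have "\<dots> \<le> M * \<rho> powr (-p)"
          using M \<rho> by (simp add: powr_mult mult_right_mono)
        finally show ?thesis .
      qed
      finally show ?thesis using True a by (simp add: dist_norm)
    next
      case False
      then show ?thesis using M by (simp add: indicator_def)
    qed
    have "(\<integral>\<^sup>+y. ennreal (indicator (A j) y * f y) \<partial>lborel)
        \<le> (\<integral>\<^sup>+y. ennreal (M * \<rho> powr (-p)) * indicator (cball x\<^sub>0 (2*\<rho>)) y \<partial>lborel)"
    proof (rule nn_integral_mono)
      fix y
      show "ennreal (indicator (A j) y * f y) \<le> ennreal (M * \<rho> powr (-p)) * indicator (cball x\<^sub>0 (2*\<rho>)) y"
        using ennreal_leI[OF pw[of y]] by (cases "y \<in> cball x\<^sub>0 (2*\<rho>)") (auto simp: indicator_def)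
    qed
    also have "\<dots> = ennreal (M * \<rho> powr (-p)) * ennreal (unit_ball_vol ?n * (2 * \<rho>) ^ ?n)"
      using \<rho> by (subst nn_integral_cmult_indicator) (auto simp: emeasure_cball)
    also have "\<dots> = ennreal (M * \<rho> powr (-p) * (unit_ball_vol ?n * (2 * \<rho>) ^ ?n))"
      using M \<rho> by (subst ennreal_mult) auto
    also have "M * \<rho> powr (-p) * (unit_ball_vol ?n * (2 * \<rho>) ^ ?n) = D * (b powr (?n - p)) ^ j"
    proof -
      have 1: "\<rho> powr (-p) = r powr (-p) * (b ^ j) powr (-p)"
        using r b by (simp add: \<rho>_def powr_mult)
      have 2: "(b ^ j) powr (-p) * (b ^ j) ^ ?n = (b powr (?n - p)) ^ j"
      proof -
        have "(b ^ j) powr (-p) * (b ^ j) ^ ?n = (b powr j) powr (-p) * (b powr j) powr ?n"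
          using b by (simp add: powr_realpow)
        also have "\<dots> = b powr (j * (?n - p))"
          using b by (simp add: powr_powr powr_add[symmetric] algebra_simps)
        also have "\<dots> = (b powr (?n - p)) ^ j"
          using b by (simp add: powr_realpow[symmetric] powr_powr mult.commute)
        finally show ?thesis .
      qed
      have 3: "(2 * \<rho>) ^ ?n = (2 * r) ^ ?n * (b ^ j) ^ ?n"
        by (simp add: \<rho>_def power_mult_distrib)
      show ?thesis unfolding D_def 1 3 2[symmetric] by (simp only: mult_ac)
    qed
    finally show ?thesis .
  qed
  have D0: "0 \<le> D" using M r by (simp add: D_def)
  have "(\<integral>\<^sup>+y. ennreal (indicator (\<Union>j. A j) y * f y) \<partial>lborel)
      \<le> (\<integral>\<^sup>+y. (\<Sum>j. ennreal (indicator (A j) y * f y)) \<partial>lborel)"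
  proof (rule nn_integral_mono)
    fix y
    show "ennreal (indicator (\<Union>j. A j) y * f y) \<le> (\<Sum>j. ennreal (indicator (A j) y * f y))"
    proof (cases "y \<in> (\<Union>j. A j)")
      case True
      then obtain j where "y \<in> A j" by blast
      then show ?thesis
        using True sum_le_suminf[of "\<lambda>j. ennreal (indicator (A j) y * f y)" "{j}"] by simp
    qed simp
  qed
  also have "\<dots> = (\<Sum>j. \<integral>\<^sup>+y. ennreal (indicator (A j) y * f y) \<partial>lborel)"
    by (rule nn_integral_suminf) simp
  also have "\<dots> \<le> (\<Sum>j. ennreal (D * (b powr (?n - p)) ^ j))"
    by (intro suminf_le ring summableI)
  also have "\<dots> = ennreal (\<Sum>j. D * (b powr (?n - p)) ^ j)"
    using D0 q by (intro suminf_ennreal2 summable_mult summable_geometric) auto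
  also have "\<dots> < \<infinity>" by simp
  finally have "integrable lborel (\<lambda>y. indicator (\<Union>j. A j) y * f y)"
    by (intro integrableI_bounded) (auto simp: f_def abs_mult)
  then have "integrable lebesgue (\<lambda>y. indicator (\<Union>j. A j) y * f y)"
    by (subst integrable_completion) auto
  then show ?thesis by (simp add: set_integrable_def A_def f_def)
qed

lemma exists_dyadic_annulus:
  fixes t :: real assumes "1 \<le> t" shows "\<exists>j. 2 ^ j \<le> t \<and> t \<le> 2 * 2 ^ j"
proof -
  have "\<exists>j. t < 2 ^ j" by (rule real_arch_pow) simp
  define m where "m = (LEAST j. t < 2 ^ j)"
  have m: "t < 2 ^ m" unfolding m_def using \<open>\<exists>j. t < 2 ^ j\<close> by (rule LeastI_ex)
  then have "m \<noteq> 0" using assms by (metis not_less power_0)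
  then obtain j where j: "m = Suc j" by (cases m) auto
  have "\<not> t < 2 ^ j" using j not_less_Least[of j "\<lambda>j. t < 2 ^ j"] by (simp add: m_def)
  then show ?thesis using m j by (intro exI[of _ j]) auto
qed

lemma integrable_radial_power_at_infinity:
  fixes x\<^sub>0 :: "'a::euclidean_space"
  assumes r: "0 < r" and p: "real DIM('a) < p"
  shows "set_integrable lebesgue (UNIV - ball x\<^sub>0 r) (\<lambda>y. 1 / norm (x\<^sub>0 - y) powr p)"
proof -
  have "(\<Union>j. {y. r * 2 ^ j \<le> norm (x\<^sub>0 - y) \<and> norm (x\<^sub>0 - y) \<le> 2 * (r * 2 ^ j)}) = UNIV - ball x\<^sub>0 r"
    (is "?U = _")
  proof (intro equalityI subsetI)
    fix y assume "y \<in> ?U"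
    then obtain j where "r * 2 ^ j \<le> norm (x\<^sub>0 - y)" by auto
    moreover have "r \<le> r * 2 ^ j" using r by simp
    ultimately show "y \<in> UNIV - ball x\<^sub>0 r" by (simp add: dist_norm)
  next
    fix y assume "y \<in> UNIV - ball x\<^sub>0 r"
    then have "1 \<le> norm (x\<^sub>0 - y) / r" using r by (simp add: dist_norm)
    from exists_dyadic_annulus[OF this] show "y \<in> ?U"
      using r by (auto simp: field_simps)
  qed
  moreover have "2 powr (real DIM('a) - p) < 1"
    using p powr_less_mono[of "real DIM('a) - p" 0 2] by simp
  ultimately show ?thesis
    using integrable_radial_power_on_annuli[of r 2 p x\<^sub>0] r by simp
qed

lemma integrable_radial_power_near_centre:
  fixes x\<^sub>0 :: "'a::euclidean_space"
  assumes r: "0 < r" and p: "p < real DIM('a)"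
  shows "set_integrable lebesgue (ball x\<^sub>0 r) (\<lambda>y. 1 / norm (x\<^sub>0 - y) powr p)"
proof -
  let ?U = "\<Union>j. {y. r * (1/2) ^ j \<le> norm (x\<^sub>0 - y) \<and> norm (x\<^sub>0 - y) \<le> 2 * (r * (1/2) ^ j)}"
  have "(1/2) powr (real DIM('a) - p) < 1"
    using p powr_less_mono2[of "real DIM('a) - p" "1/2" 1] by simp
  then have "set_integrable lebesgue ?U (\<lambda>y. 1 / norm (x\<^sub>0 - y) powr p)"
    using integrable_radial_power_on_annuli[of r "1/2" p x\<^sub>0] r by simp
  then have "set_integrable lebesgue (ball x\<^sub>0 r - {x\<^sub>0}) (\<lambda>y. 1 / norm (x\<^sub>0 - y) powr p)"
  proof (rule set_integrable_subset)
    show "ball x\<^sub>0 r - {x\<^sub>0} \<subseteq> ?U"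
    proof
      fix y assume "y \<in> ball x\<^sub>0 r - {x\<^sub>0}"
      then have y: "norm (x\<^sub>0 - y) < r" "0 < norm (x\<^sub>0 - y)" by (auto simp: dist_norm)
      then have "1 \<le> r / norm (x\<^sub>0 - y)" by simp
      from exists_dyadic_annulus[OF this] obtain j
        where j: "2 ^ j \<le> r / norm (x\<^sub>0 - y)" "r / norm (x\<^sub>0 - y) \<le> 2 * 2 ^ j" by blast
      have "r * (1/2) ^ Suc j \<le> norm (x\<^sub>0 - y)" "norm (x\<^sub>0 - y) \<le> 2 * (r * (1/2) ^ Suc j)"
        using j y by (auto simp: field_simps)
      then show "y \<in> ?U" by blast
    qed
  qed auto
  \<comment> \<open>At the centre the function takes the value \<open>1 / 0 = 0\<close>.\<close>
  moreover have "(\<lambda>y. indicator (ball x\<^sub>0 r - {x\<^sub>0}) y *\<^sub>R (1 / norm (x\<^sub>0 - y) powr p))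
      = (\<lambda>y. indicator (ball x\<^sub>0 r) y *\<^sub>R (1 / norm (x\<^sub>0 - y) powr p))"
    by (auto simp: indicator_def)
  ultimately show ?thesis by (simp only: set_integrable_def)
qed

section \<open>Second-order conditions at a maximum\<close>

text \<open>The gradient vanishes at an interior maximum and is differentiable there, so it grows at most
  linearly near the maximum; the mean value inequality on the ball of radius \<open>norm (x\<^sub>0 - y)\<close>
  turns this into a quadratic bound on the increment.\<close>

lemma C2_on_quadratic_bound_at_max:
  assumes "open S" "C2_on S u" "x\<^sub>0 \<in> S" and max: "\<forall>y\<in>S. u y \<le> u x\<^sub>0"
  obtains M r where "0 < r" "0 \<le> M" "\<forall>y\<in>ball x\<^sub>0 r. u x\<^sub>0 - u y \<le> M * (norm (x\<^sub>0 - y))\<^sup>2"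
proof -
  obtain u' u'' where
    u': "\<forall>x\<in>S. (u has_derivative blinfun_apply (u' x)) (at x)" and
    u'': "\<forall>x\<in>S. (u' has_derivative blinfun_apply (u'' x)) (at x)"
    using assms(2) unfolding C2_on_def by blast
  have "blinfun_apply (u' x\<^sub>0) = (\<lambda>v. 0)"
    using differential_zero_maxmin[OF assms(3,1)] u' assms(3) max by blast
  then have zero: "u' x\<^sub>0 = 0" by (intro blinfun_eqI) simp
  have "(u' has_derivative blinfun_apply (u'' x\<^sub>0)) (at x\<^sub>0 within UNIV)" using u'' assms(3) by auto
  then obtain d where d: "0 < d"
    "\<And>y. norm (y - x\<^sub>0) < d \<Longrightarrow> norm (u' y - u' x\<^sub>0 - u'' x\<^sub>0 (y - x\<^sub>0)) \<le> 1 * norm (y - x\<^sub>0)"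
    unfolding has_derivative_within_alt by (metis UNIV_I zero_less_one)
  define M where "M = 1 + norm (u'' x\<^sub>0)"
  have grad: "norm (u' y) \<le> M * norm (y - x\<^sub>0)" if "norm (y - x\<^sub>0) < d" for y
  proof -
    have "norm (u' y) \<le> norm (u' y - u' x\<^sub>0 - u'' x\<^sub>0 (y - x\<^sub>0)) + norm (u'' x\<^sub>0 (y - x\<^sub>0))"
      using norm_triangle_sub[of "u' y" "u'' x\<^sub>0 (y - x\<^sub>0)"] by (simp add: zero)
    also have "\<dots> \<le> 1 * norm (y - x\<^sub>0) + norm (u'' x\<^sub>0) * norm (y - x\<^sub>0)"
      by (intro add_mono d that norm_blinfun)
    finally show ?thesis by (simp add: M_def algebra_simps)
  qed
  obtain e where e: "0 < e" "ball x\<^sub>0 e \<subseteq> S" using assms(1,3) openE by blast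
  have "u x\<^sub>0 - u y \<le> M * (norm (x\<^sub>0 - y))\<^sup>2" if y: "y \<in> ball x\<^sub>0 (min d e)" for y
  proof -
    let ?R = "norm (x\<^sub>0 - y)"
    have sub: "cball x\<^sub>0 ?R \<subseteq> S" "\<And>z. z \<in> cball x\<^sub>0 ?R \<Longrightarrow> norm (z - x\<^sub>0) < d"
      using y e by (auto simp: dist_norm norm_minus_commute subset_iff)
    have "norm (u x\<^sub>0 - u y) \<le> (M * ?R) * norm (x\<^sub>0 - y)"
    proof (rule differentiable_bound)
      show "(u has_derivative blinfun_apply (u' z)) (at z within cball x\<^sub>0 ?R)"
        if "z \<in> cball x\<^sub>0 ?R" for z
        using u' sub(1) that has_derivative_at_withinI by blast
      show "onorm (blinfun_apply (u' z)) \<le> M * ?R" if z: "z \<in> cball x\<^sub>0 ?R" for z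
      proof -
        have "onorm (blinfun_apply (u' z)) \<le> M * norm (z - x\<^sub>0)"
          using grad[OF sub(2)[OF z]] by (simp add: norm_blinfun.rep_eq)
        also have "\<dots> \<le> M * ?R"
          using z by (intro mult_left_mono) (auto simp: M_def dist_norm norm_minus_commute)
        finally show ?thesis .
      qed
    qed (auto simp: dist_norm)
    then show ?thesis by (simp add: power2_eq_square)
  qed
  then show ?thesis using that[of "min d e" M] d e by (simp add: M_def)
qed

text \<open>Each pure second derivative is that of the restriction \<open>h\<close> to a line. Were it positive, \<open>h'\<close>
  would be positive just to the right of the maximum, and \<open>h\<close> would increase there.\<close>

lemma laplacian_nonpos_at_max:
  fixes u :: "real ^ 'n \<Rightarrow> real"
  assumes "open S" "C2_on S u" "x\<^sub>0 \<in> S" and max: "\<forall>y\<in>S. u y \<le> u x\<^sub>0"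
  shows "laplacian u x\<^sub>0 \<le> 0"
  unfolding laplacian_def
proof (rule sum_nonpos)
  fix i :: 'n
  obtain u' u'' where
    u': "\<And>x. x\<in>S \<Longrightarrow> (u has_derivative blinfun_apply (u' x)) (at x)" and
    u'': "\<And>x. x\<in>S \<Longrightarrow> (u' has_derivative blinfun_apply (u'' x)) (at x)"
    using assms(2) unfolding C2_on_def by blast
  define e where "e = (axis i 1 :: real ^ 'n)"
  define l where "l t = x\<^sub>0 + t *\<^sub>R e" for t
  define h where "h t = u (l t)" for t
  define h' where "h' t = blinfun_apply (u' (l t)) e" for t
  have l: "(l has_derivative (\<lambda>t. t *\<^sub>R e)) (at t)" for t
    unfolding l_def by (auto intro!: derivative_eq_intros)
  have dir: "((\<lambda>t. u (x + t *\<^sub>R e)) has_field_derivative blinfun_apply (u' x) e) (at 0)"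
    if "x \<in> S" for x
  proof -
    have "((\<lambda>t. u (x + t *\<^sub>R e)) has_derivative (\<lambda>t. blinfun_apply (u' x) (t *\<^sub>R e))) (at 0)"
      by (rule has_derivative_compose[of "\<lambda>t. x + t *\<^sub>R e", where g = u])
         (use u'[OF that] in \<open>auto intro!: derivative_eq_intros\<close>)
    then show ?thesis
      by (simp add: has_field_derivative_def blinfun.scaleR_right mult.commute[of _ "blinfun_apply (u' x) e"])
  qed
  have partial: "partial_derivative i u x = blinfun_apply (u' x) e" if "x \<in> S" for x
    unfolding partial_derivative_def using dir[OF that] by (simp add: e_def DERIV_imp_deriv)
  obtain d where d: "0 < d" "ball x\<^sub>0 d \<subseteq> S" using assms(1,3) openE by blast
  have lS: "l t \<in> S" if "t \<in> ball 0 d" for t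
    using that d by (auto simp: l_def e_def dist_norm subset_iff)
  have h: "(h has_field_derivative h' t) (at t)" if "t \<in> ball 0 d" for t
  proof -
    have "(h has_derivative (\<lambda>r. blinfun_apply (u' (l t)) (r *\<^sub>R e))) (at t)"
      unfolding h_def by (rule has_derivative_compose[OF l u'[OF lS[OF that]]])
    then show ?thesis
      by (simp add: has_field_derivative_def h'_def blinfun.scaleR_right mult.commute[of _ "blinfun_apply (u' (l t)) e"])
  qed
  have x0: "l 0 = x\<^sub>0" by (simp add: l_def)
  have h'': "(h' has_field_derivative u'' x\<^sub>0 e e) (at 0)"
  proof -
    have "((\<lambda>t. u' (l t)) has_derivative (\<lambda>t. u'' x\<^sub>0 (t *\<^sub>R e))) (at 0)"
      by (rule has_derivative_compose[OF l]) (use u'' assms(3) x0 in auto)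
    then have "(h' has_derivative (\<lambda>t. u'' x\<^sub>0 (t *\<^sub>R e) e)) (at 0)"
      unfolding h'_def by (auto intro!: derivative_eq_intros)
    then show ?thesis
      by (simp add: has_field_derivative_def blinfun.scaleR_right blinfun.scaleR_left mult.commute[of _ "u'' x\<^sub>0 e e"])
  qed
  have "partial_derivative i (partial_derivative i u) x\<^sub>0 = u'' x\<^sub>0 e e"
  proof -
    have "((\<lambda>t. partial_derivative i u (x\<^sub>0 + t *\<^sub>R axis i 1)) has_field_derivative u'' x\<^sub>0 e e) (at 0)"
      by (rule has_field_derivative_transform_within_open[OF h'', of "ball 0 d"])
         (use d lS in \<open>auto simp: partial h'_def l_def e_def\<close>)
    then show ?thesis by (simp add: partial_derivative_def[of i "partial_derivative i u"] DERIV_imp_deriv)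
  qed
  moreover have "u'' x\<^sub>0 e e \<le> 0"
  proof (rule ccontr)
    assume "\<not> ?thesis"
    then obtain \<delta> where \<delta>: "0 < \<delta>" "\<And>t. 0 < t \<Longrightarrow> t < \<delta> \<Longrightarrow> h' 0 < h' t"
      using DERIV_pos_inc_right[OF h''] by force
    have "h' 0 = 0"
      using d by (intro DERIV_local_max[OF h[of 0] d(1)])
        (use max lS x0 in \<open>auto simp: h_def\<close>)
    define t where "t = min \<delta> d / 2"
    have t: "0 < t" "t < \<delta>" "t < d" using \<delta> d by (auto simp: t_def)
    then obtain z where z: "0 < z" "z < t" "h t - h 0 = (t - 0) * h' z"
      using MVT2[of 0 t h h'] h by auto
    then have "0 < h t - h 0" using t \<delta>(2)[of z] \<open>h' 0 = 0\<close> by simp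
    then show False using max lS[of t] t x0 by (auto simp: h_def)
  qed
  ultimately show "partial_derivative i (partial_derivative i u) x\<^sub>0 \<le> 0" by simp
qed

section \<open>The fractional Laplacian at a global maximum\<close>

lemma borel_measurable_of_locally_integrable:
  fixes u :: "real ^ 'n \<Rightarrow> real"
  assumes "locally_integrable u"
  shows "u \<in> borel_measurable lebesgue"
proof (rule borel_measurable_LIMSEQ_real)
  show "(\<lambda>m. indicator (cball 0 (real m)) x *\<^sub>R u x) \<longlonglongrightarrow> u x" for x
  proof (rule tendsto_eventually)
    obtain N :: nat where "norm x \<le> real N" using real_arch_simple by blast
    then have "indicator (cball 0 (real m)) x *\<^sub>R u x = u x" if "N \<le> m" for m
      using that by (auto simp: indicator_def)
    then show "\<forall>\<^sub>F m in sequentially. indicator (cball 0 (real m)) x *\<^sub>R u x = u x"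
      by (rule eventually_sequentiallyI)
  qed
  show "(\<lambda>x. indicator (cball 0 (real m)) x *\<^sub>R u x) \<in> borel_measurable lebesgue" for m
    using assms unfolding locally_integrable_def set_integrable_def
    by (blast intro: borel_measurable_integrable compact_cball)
qed

text \<open>Away from \<open>x\<^sub>0\<close> the kernel centred at \<open>x\<^sub>0\<close> is comparable to the weight of the space,
  which is centred at the origin.\<close>

lemma L2s_integrable_away_from_point:
  fixes u :: "real ^ 'n \<Rightarrow> real"
  assumes "u \<in> L2s_space s" "0 < s" "0 < r"
  shows "set_integrable lebesgue (UNIV - ball x\<^sub>0 r)
           (\<lambda>y. u y / norm (x\<^sub>0 - y) powr (real CARD('n) + 2 * s))"
proof -
  define p where "p = real CARD('n) + 2 * s"
  have p: "0 < p" using assms(2) by (simp add: p_def add_pos_pos)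
  have loc: "locally_integrable u" and
    int: "integrable lebesgue (\<lambda>x. \<bar>u x\<bar> / (1 + norm x powr p))"
    using assms(1) by (auto simp: L2s_space_def p_def)
  note [measurable] = borel_measurable_of_locally_integrable[OF loc]
  \<comment> \<open>For \<open>t = norm (x\<^sub>0 - y)\<close> at least \<open>r\<close>, the first term of \<open>D\<close> bounds \<open>1 / t powr p\<close>
    and the second bounds \<open>norm y powr p / t powr p\<close>.\<close>
  define D where "D = r powr (-p) + (norm x\<^sub>0 / r + 1) powr p"
  have [measurable]: "(\<lambda>y. norm (x\<^sub>0 - y) powr p) \<in> borel_measurable lebesgue"
    by (intro measurable_completion) simp
  have [measurable]: "ball x\<^sub>0 e \<in> sets lebesgue" for e by simp
  have "integrable lebesgue (\<lambda>y. D * (\<bar>u y\<bar> / (1 + norm y powr p)))"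
    by (intro integrable_mult_right int)
  then have "integrable lebesgue (\<lambda>y. indicator (UNIV - ball x\<^sub>0 r) y *\<^sub>R (u y / norm (x\<^sub>0 - y) powr p))"
  proof (rule Bochner_Integration.integrable_bound)
    have "norm (indicator (UNIV - ball x\<^sub>0 r) y *\<^sub>R (u y / norm (x\<^sub>0 - y) powr p))
        \<le> norm (D * (\<bar>u y\<bar> / (1 + norm y powr p)))" for y
    proof (cases "y \<in> ball x\<^sub>0 r")
      case False
      define t where "t = norm (x\<^sub>0 - y)"
      have t: "r \<le> t" "0 < t" using False assms(3) by (auto simp: t_def dist_norm)
      have "norm y \<le> norm x\<^sub>0 + t" using norm_triangle_sub[of y x\<^sub>0] by (simp add: t_def norm_minus_commute)
      also have "norm x\<^sub>0 \<le> norm x\<^sub>0 / r * t"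
        using t assms(3) mult_left_mono[of r t "norm x\<^sub>0 / r"] by simp
      finally have "norm y \<le> (norm x\<^sub>0 / r + 1) * t" by (simp add: algebra_simps)
      then have "norm y powr p \<le> ((norm x\<^sub>0 / r + 1) * t) powr p"
        using p by (intro powr_mono2) auto
      also have "\<dots> = (norm x\<^sub>0 / r + 1) powr p * t powr p"
        using t assms(3) by (simp add: powr_mult)
      finally have far: "norm y powr p \<le> (norm x\<^sub>0 / r + 1) powr p * t powr p" .
      have "1 = r powr (-p) * r powr p" using assms(3) by (simp add: powr_minus)
      also have "\<dots> \<le> r powr (-p) * t powr p"
        using t p assms(3) by (intro mult_left_mono powr_mono2) auto
      finally have "1 + norm y powr p \<le> D * t powr p" using far by (simp add: D_def algebra_simps)
      moreover have "0 < 1 + norm y powr p" by (simp add: add_pos_nonneg)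
      moreover have "0 < t powr p" using t by simp
      ultimately have "1 / t powr p \<le> D / (1 + norm y powr p)"
        by (simp add: field_simps)
      then have "\<bar>u y\<bar> * (1 / t powr p) \<le> \<bar>u y\<bar> * (D / (1 + norm y powr p))"
        by (intro mult_left_mono) auto
      also have "\<dots> = D * (\<bar>u y\<bar> / (1 + norm y powr p))" by simp
      also have "\<dots> \<le> \<bar>D * (\<bar>u y\<bar> / (1 + norm y powr p))\<bar>" by (rule abs_ge_self)
      finally show ?thesis using False by (simp add: t_def)
    qed simp
    then show "AE y in lebesgue. norm (indicator (UNIV - ball x\<^sub>0 r) y *\<^sub>R (u y / norm (x\<^sub>0 - y) powr p))
        \<le> norm (D * (\<bar>u y\<bar> / (1 + norm y powr p)))" by simp
  qed measurable
  then show ?thesis by (simp add: set_integrable_def p_def)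
qed

text \<open>At a global maximum the principal value is an honest integral. Near \<open>x\<^sub>0\<close> the quadratic bound
  lowers the singularity of the kernel from \<open>n + 2 * s\<close> to \<open>n + 2 * s - 2 < n\<close>, and away from
  \<open>x\<^sub>0\<close> both the kernel and its product with \<open>u\<close> are integrable. Dominated convergence then
  removes the truncation. This step also guarantees that the limit in the definition of
  the fractional Laplacian exists, without which its value would be arbitrary.\<close>

lemma fractional_laplacian_at_global_max:
  fixes u :: "real ^ 'n \<Rightarrow> real"
  assumes s: "0 < s" "s < 1" and S: "open S" "C2_on S u" "x\<^sub>0 \<in> S"
    and u: "u \<in> L2s_space s" and max: "\<And>y. u y \<le> u x\<^sub>0"
  defines "g \<equiv> \<lambda>y. (u x\<^sub>0 - u y) / norm (x\<^sub>0 - y) powr (real CARD('n) + 2 * s)"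
  shows "integrable lebesgue g" and "fractional_laplacian \<kappa> s u x\<^sub>0 = \<kappa> * (LINT y|lebesgue. g y)"
proof -
  define p where "p = real CARD('n) + 2 * s"
  have g: "g y = (u x\<^sub>0 - u y) / norm (x\<^sub>0 - y) powr p" for y by (simp add: g_def p_def)
  have g0: "0 \<le> g y" for y unfolding g using max[of y] by simp
  have [measurable]: "u \<in> borel_measurable lebesgue"
    using u borel_measurable_of_locally_integrable by (auto simp: L2s_space_def)
  have [measurable]: "(\<lambda>y. norm (x\<^sub>0 - y) powr p) \<in> borel_measurable lebesgue"
    by (intro measurable_completion) simp
  have [measurable]: "ball x\<^sub>0 e \<in> sets lebesgue" for e by simp
  have g_meas [measurable]: "g \<in> borel_measurable lebesgue"
    unfolding g[abs_def] by measurable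
  have "\<forall>y\<in>S. u y \<le> u x\<^sub>0" using max by simp
  then obtain M r where r: "0 < r" and M: "0 \<le> M"
    and quad: "\<forall>y\<in>ball x\<^sub>0 r. u x\<^sub>0 - u y \<le> M * (norm (x\<^sub>0 - y))\<^sup>2"
    by (rule C2_on_quadratic_bound_at_max[OF S])
  have near: "set_integrable lebesgue (ball x\<^sub>0 r) g"
  proof -
    have "set_integrable lebesgue (ball x\<^sub>0 r) (\<lambda>y. M * (1 / norm (x\<^sub>0 - y) powr (p - 2)))"
      using r s by (intro set_integrable_mult_right integrable_radial_power_near_centre) (simp_all add: p_def)
    then show ?thesis
      unfolding set_integrable_def
    proof (rule Bochner_Integration.integrable_bound)
      have "norm (indicator (ball x\<^sub>0 r) y *\<^sub>R g y)
          \<le> norm (indicator (ball x\<^sub>0 r) y *\<^sub>R (M * (1 / norm (x\<^sub>0 - y) powr (p - 2))))" for y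
      proof (cases "y \<in> ball x\<^sub>0 r \<and> y \<noteq> x\<^sub>0")
        case True
        then have "0 < norm (x\<^sub>0 - y)" by auto
        then have "norm (x\<^sub>0 - y) powr p = norm (x\<^sub>0 - y) powr (p - 2) * (norm (x\<^sub>0 - y))\<^sup>2"
          by (simp add: powr_diff)
        moreover have "g y \<le> M * (norm (x\<^sub>0 - y))\<^sup>2 / norm (x\<^sub>0 - y) powr p"
          unfolding g using quad True by (intro divide_right_mono) auto
        ultimately have "g y \<le> M / norm (x\<^sub>0 - y) powr (p - 2)"
          using True by auto
        then show ?thesis using True g0[of y] M by simp
      qed (auto simp: g)
      then show "AE y in lebesgue. norm (indicator (ball x\<^sub>0 r) y *\<^sub>R g y)
          \<le> norm (indicator (ball x\<^sub>0 r) y *\<^sub>R (M * (1 / norm (x\<^sub>0 - y) powr (p - 2))))" by simp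
    qed measurable
  qed
  have far: "set_integrable lebesgue (UNIV - ball x\<^sub>0 r) g"
  proof -
    have "set_integrable lebesgue (UNIV - ball x\<^sub>0 r)
        (\<lambda>y. u x\<^sub>0 * (1 / norm (x\<^sub>0 - y) powr p) - u y / norm (x\<^sub>0 - y) powr p)"
      unfolding p_def using r s u
      by (intro set_integral_diff(1) set_integrable_mult_right integrable_radial_power_at_infinity
          L2s_integrable_away_from_point) auto
    then show ?thesis by (simp add: g[abs_def] diff_divide_distrib)
  qed
  have "set_integrable lebesgue (ball x\<^sub>0 r \<union> (UNIV - ball x\<^sub>0 r)) g"
    by (rule set_integrable_Un[OF near far]) auto
  moreover have "ball x\<^sub>0 r \<union> (UNIV - ball x\<^sub>0 r) = UNIV" by auto
  ultimately show int: "integrable lebesgue g" by (simp add: set_integrable_def)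
  have "((\<lambda>\<epsilon>. LINT y:(UNIV - ball x\<^sub>0 \<epsilon>)|lebesgue. g y) \<longlongrightarrow> (LINT y|lebesgue. g y)) (at_right 0)"
  proof (rule tendsto_at_right_sequentially[where b = 1])
    fix \<epsilon> :: "nat \<Rightarrow> real"
    assume \<epsilon>: "\<And>m. 0 < \<epsilon> m" "\<epsilon> \<longlonglongrightarrow> 0"
    show "(\<lambda>m. LINT y:(UNIV - ball x\<^sub>0 (\<epsilon> m))|lebesgue. g y) \<longlonglongrightarrow> (LINT y|lebesgue. g y)"
      unfolding set_lebesgue_integral_def
    proof (rule integral_dominated_convergence[OF _ _ int])
      have "(\<lambda>m. indicator (UNIV - ball x\<^sub>0 (\<epsilon> m)) y *\<^sub>R g y) \<longlonglongrightarrow> g y" for y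
      proof (cases "y = x\<^sub>0")
        case False
        then have "\<forall>\<^sub>F m in sequentially. \<epsilon> m < dist x\<^sub>0 y" using \<epsilon>(2) by (intro order_tendstoD) auto
        then have "\<forall>\<^sub>F m in sequentially. indicator (UNIV - ball x\<^sub>0 (\<epsilon> m)) y *\<^sub>R g y = g y"
          by eventually_elim auto
        then show ?thesis by (rule tendsto_eventually)
      qed (simp add: g)
      then show "AE y in lebesgue. (\<lambda>m. indicator (UNIV - ball x\<^sub>0 (\<epsilon> m)) y *\<^sub>R g y) \<longlonglongrightarrow> g y" by simp
      show "AE y in lebesgue. norm (indicator (UNIV - ball x\<^sub>0 (\<epsilon> m)) y *\<^sub>R g y) \<le> g y" for m
        using g0 by (auto simp: indicator_def)
    qed measurable
  qed simp
  then show "fractional_laplacian \<kappa> s u x\<^sub>0 = \<kappa> * (LINT y|lebesgue. g y)"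
    unfolding fractional_laplacian_def g_def by (subst tendsto_Lim) auto
qed

section \<open>Narrow regions\<close>

lemma coordinate_diff_le_width:
  assumes "bounded S" "x \<in> S" "y \<in> S"
  shows "x $ k - y $ k \<le> width k S"
proof -
  obtain B where B: "\<And>x. x \<in> S \<Longrightarrow> norm x \<le> B" using assms(1) bounded_iff by blast
  have "bdd_above {x $ k - y $ k | x y. x \<in> S \<and> y \<in> S}"
  proof (rule bdd_aboveI[of _ "2 * B"])
    fix d assume "d \<in> {x $ k - y $ k | x y. x \<in> S \<and> y \<in> S}"
    then obtain x y where "x \<in> S" "y \<in> S" "d = x $ k - y $ k" by blast
    then show "d \<le> 2 * B"
      using B[of x] B[of y] component_le_norm_cart[of x k] component_le_norm_cart[of y k] by linarith
  qed
  then show ?thesis unfolding width_def using assms(2,3) by (intro cSup_upper) auto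
qed

lemma width_pos:
  fixes S :: "(real ^ 'n) set"
  assumes "open S" "bounded S" "x \<in> S"
  shows "0 < width k S"
proof -
  obtain e where e: "0 < e" "cball x e \<subseteq> S" using assms(1,3) open_contains_cball by blast
  have "x + e *\<^sub>R axis k 1 \<in> S" using e by (auto simp: dist_norm subset_iff)
  from coordinate_diff_le_width[OF assms(2) this assms(3), of k] show ?thesis using e by simp
qed

text \<open>The integrand is nonnegative, so it may be restricted to the ball of radius the width \<open>l\<close>
  around the point at distance \<open>3 * l\<close> from \<open>x\<^sub>0\<close> in direction \<open>k\<close>. The \<open>k\<close>-th
  coordinate on this ball exceeds that of \<open>x\<^sub>0\<close> by more than \<open>2 * l\<close>, so the ball misses
  \<open>S\<close>; hence the numerator there is at least \<open>u x\<^sub>0\<close>, while the distance to \<open>x\<^sub>0\<close> is at most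
  \<open>4 * l\<close>.\<close>

lemma fractional_laplacian_ge_at_positive_max:
  fixes u :: "real ^ 'n \<Rightarrow> real"
  assumes s: "0 < s" "s < 1" and S: "open S" "C2_on S u" "x\<^sub>0 \<in> S" and bounded: "bounded S"
    and u: "u \<in> L2s_space s" and max: "\<And>y. u y \<le> u x\<^sub>0"
    and outside: "\<forall>y\<in>-S. u y \<le> 0" and pos: "0 < u x\<^sub>0" and \<kappa>: "0 < \<kappa>"
  shows "\<kappa> * unit_ball_vol CARD('n) / 4 powr (real CARD('n) + 2 * s) * width k S powr (- (2 * s)) * u x\<^sub>0
    \<le> fractional_laplacian \<kappa> s u x\<^sub>0"
proof -
  define p where "p = real CARD('n) + 2 * s"
  define l where "l = width k S"
  define z where "z = x\<^sub>0 + (3 * l) *\<^sub>R axis k 1"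
  have l: "0 < l" using width_pos[OF S(1) bounded S(3)] by (simp add: l_def)
  have p: "0 < p" using s by (simp add: p_def add_pos_pos)
  let ?g = "\<lambda>y. (u x\<^sub>0 - u y) / norm (x\<^sub>0 - y) powr p"
  note frac = fractional_laplacian_at_global_max[OF s S u max, folded p_def]
  have "u x\<^sub>0 / (4 * l) powr p * (unit_ball_vol CARD('n) * l ^ CARD('n))
      = (LINT y|lebesgue. indicator (ball z l) y * (u x\<^sub>0 / (4 * l) powr p))"
    using l by (simp add: content_ball)
  also have "\<dots> \<le> (LINT y|lebesgue. ?g y)"
  proof (rule integral_mono)
    show "integrable lebesgue (\<lambda>y. indicator (ball z l) y * (u x\<^sub>0 / (4 * l) powr p))"
      by (intro integrable_mult_left integrable_real_indicator) (auto simp: emeasure_ball l less_imp_le)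
    show "integrable lebesgue ?g" by (rule frac(1))
    fix y
    show "indicator (ball z l) y * (u x\<^sub>0 / (4 * l) powr p) \<le> ?g y"
    proof (cases "y \<in> ball z l")
      case True
      then have zy: "norm (z - y) < l" by (simp add: dist_norm)
      have "\<bar>(z - y) $ k\<bar> < l" using component_le_norm_cart[of "z - y" k] zy by linarith
      then have "l < y $ k - x\<^sub>0 $ k" using l by (simp add: z_def)
      then have "y \<notin> S" using coordinate_diff_le_width[OF bounded _ S(3), of y k] by (auto simp: l_def)
      then have "u x\<^sub>0 \<le> u x\<^sub>0 - u y" using outside by simp
      moreover have "norm (x\<^sub>0 - y) \<le> 4 * l"
      proof -
        have "norm (x\<^sub>0 - y) \<le> norm (x\<^sub>0 - z) + norm (z - y)"
          using norm_triangle_ineq[of "x\<^sub>0 - z" "z - y"] by simp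
        then show ?thesis using zy l by (simp add: z_def)
      qed
      moreover have "0 < norm (x\<^sub>0 - y)" using S(3) \<open>y \<notin> S\<close> by auto
      ultimately have "u x\<^sub>0 / (4 * l) powr p \<le> ?g y"
        using p pos by (intro frac_le powr_mono2) auto
      then show ?thesis using True by simp
    next
      case False
      then show ?thesis using max[of y] by simp
    qed
  qed
  finally have lower: "\<kappa> * (u x\<^sub>0 / (4 * l) powr p * (unit_ball_vol CARD('n) * l ^ CARD('n)))
      \<le> fractional_laplacian \<kappa> s u x\<^sub>0" unfolding frac(2) using \<kappa> by (intro mult_left_mono) auto
  have "\<kappa> * (u x\<^sub>0 / (4 * l) powr p * (unit_ball_vol CARD('n) * l ^ CARD('n)))
      = \<kappa> * unit_ball_vol CARD('n) * (l ^ CARD('n) / (4 * l) powr p) * u x\<^sub>0" by simp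
  also have "l ^ CARD('n) / (4 * l) powr p = l powr (- (2 * s)) / 4 powr p"
    using l by (simp add: powr_mult p_def powr_add powr_realpow powr_minus field_simps)
  finally show ?thesis using lower by (simp add: p_def l_def)
qed

section \<open>Maximum principles\<close>

lemma zero_of_AE_zero:
  fixes u :: "'a::euclidean_space \<Rightarrow> real"
  assumes "open S" "continuous_on S u" "AE x in lebesgue. u x = 0" "x \<in> S"
  shows "u x = 0"
proof (rule ccontr)
  assume "u x \<noteq> 0"
  have "open (S \<inter> u -` (-{0}))"
    using assms(1,2) by (intro continuous_open_preimage) auto
  moreover have "negligible (S \<inter> u -` (-{0}))"
  proof -
    obtain N where N: "N \<in> null_sets lebesgue" "{x. u x \<noteq> 0} \<subseteq> N"
      using assms(3) by (auto simp: eventually_ae_filter)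
    show ?thesis
    proof (rule negligible_subset)
      show "negligible N" using N(1) by (simp add: negligible_iff_null_sets)
    qed (use N(2) in auto)
  qed
  ultimately have "S \<inter> u -` (-{0}) = {}" using open_not_negligible by blast
  then show False using \<open>u x \<noteq> 0\<close> assms(4) by auto
qed

lemma C2_on_imp_continuous_on:
  assumes "C2_on S u" shows "continuous_on S u"
  using assms unfolding C2_on_def
  by (meson continuous_at_imp_continuous_on has_derivative_continuous)

text \<open>At a positive maximum the nonlocal term is at least \<open>A * l powr (- (2 * s)) * w x\<^sub>0\<close> and
  \<open>- laplacian w x\<^sub>0\<close> is nonnegative, so the inequality forces
  \<open>c x\<^sub>0 \<le> - A * l powr (- (2 * s))\<close>. Raised to the power \<open>1 / (2 * s)\<close>, this is what
  narrowness excludes.\<close>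

lemma maximum_principle_narrow:
  fixes w :: "real ^ 'n \<Rightarrow> real"
  assumes s: "0 < s" "s < 1" and \<kappa>: "0 < \<kappa>"
    and S: "open S" "C2_on S w" and bounded: "bounded S"
    and w: "w \<in> L2s_space s" and usc: "upper_semicontinuous_on (closure S) w"
    and ineq: "\<forall>x\<in>S. fractional_laplacian \<kappa> s w x - laplacian w x + c x * w x \<le> 0"
    and outside: "\<forall>x\<in>-S. w x \<le> 0" and bdd: "bdd_below (c ` S)"
    and narrow: "width k S * \<bar>INF x\<in>S. c x\<bar> powr (1 / (2 * s))
      < (\<kappa> * unit_ball_vol CARD('n) / 4 powr (real CARD('n) + 2 * s)) powr (1 / (2 * s))"
      (is "_ < ?A powr _")
  shows "\<forall>x\<in>S. w x \<le> 0"
proof (rule ccontr)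
  assume "\<not> ?thesis"
  then obtain x where x: "x \<in> S" "0 < w x" by auto
  have "compact (closure S)" "closure S \<noteq> {}"
    using bounded x closure_subset by (auto simp: compact_closure)
  then obtain x\<^sub>0 where x0: "x\<^sub>0 \<in> closure S" "\<forall>y\<in>closure S. w y \<le> w x\<^sub>0"
    using upper_semicontinuous_on_attains_sup[OF _ _ usc] by blast
  have pos: "0 < w x\<^sub>0" using x x0 closure_subset by (meson less_le_trans subsetD)
  then have S0: "x\<^sub>0 \<in> S" using outside by force
  have max: "w y \<le> w x\<^sub>0" for y
    using x0(2) outside pos closure_subset[of S] by (cases "y \<in> S") force+
  define l where "l = width k S"
  have l: "0 < l" using width_pos[OF S(1) bounded S0] by (simp add: l_def)
  have A: "0 < ?A" using \<kappa> by simp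
  have "?A * l powr (- (2 * s)) * w x\<^sub>0 \<le> fractional_laplacian \<kappa> s w x\<^sub>0"
    using fractional_laplacian_ge_at_positive_max[OF s S S0 bounded w max outside pos \<kappa>]
    by (simp add: l_def)
  moreover have "laplacian w x\<^sub>0 \<le> 0" using laplacian_nonpos_at_max[OF S S0] max by blast
  moreover have "fractional_laplacian \<kappa> s w x\<^sub>0 - laplacian w x\<^sub>0 + c x\<^sub>0 * w x\<^sub>0 \<le> 0"
    using ineq S0 by blast
  ultimately have "(?A * l powr (- (2 * s)) + c x\<^sub>0) * w x\<^sub>0 \<le> 0"
    by (simp add: distrib_right)
  then have "?A * l powr (- (2 * s)) \<le> - c x\<^sub>0" using pos by (simp add: mult_le_0_iff)
  also have "- c x\<^sub>0 \<le> \<bar>INF x\<in>S. c x\<bar>" using cINF_lower[OF bdd S0] by linarith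
  finally have c_large: "?A * l powr (- (2 * s)) \<le> \<bar>INF x\<in>S. c x\<bar>" .
  have "0 \<le> ?A * l powr (- (2 * s))"
    by (intro mult_nonneg_nonneg powr_ge_zero less_imp_le[OF A])
  then have "(?A * l powr (- (2 * s))) powr (1 / (2 * s)) \<le> \<bar>INF x\<in>S. c x\<bar> powr (1 / (2 * s))"
    using c_large s by (intro powr_mono2) simp_all
  also have "(?A * l powr (- (2 * s))) powr (1 / (2 * s)) = ?A powr (1 / (2 * s)) / l"
    using A l s by (simp only: powr_mult less_imp_le powr_ge_zero powr_powr) (simp add: powr_minus_divide)
  finally have "?A powr (1 / (2 * s)) \<le> l * \<bar>INF x\<in>S. c x\<bar> powr (1 / (2 * s))"
    using l by (simp add: field_simps)
  then show False using narrow by (simp add: l_def)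
qed

text \<open>At an interior zero of a nonpositive function both parts of the operator are nonnegative, so the
  inequality forces the nonlocal part to vanish; it is the integral of the nonnegative function
  \<open>- w\<close> against a positive kernel.\<close>

lemma strong_maximum_principle:
  fixes w :: "real ^ 'n \<Rightarrow> real"
  assumes s: "0 < s" "s < 1" and \<kappa>: "0 < \<kappa>" and S: "open S" "C2_on S w" "x\<^sub>0 \<in> S"
    and w: "w \<in> L2s_space s"
    and ineq: "fractional_laplacian \<kappa> s w x\<^sub>0 - laplacian w x\<^sub>0 \<le> 0"
    and nonpos: "\<And>x. w x \<le> 0" and zero: "w x\<^sub>0 = 0"
  shows "AE x in lebesgue. w x = 0"
proof -
  have max: "w y \<le> w x\<^sub>0" for y using nonpos zero by simp
  define g where "g y = (w x\<^sub>0 - w y) / norm (x\<^sub>0 - y) powr (real CARD('n) + 2 * s)" for y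
  note frac = fractional_laplacian_at_global_max[OF s S w max, folded g_def]
  have "laplacian w x\<^sub>0 \<le> 0" using laplacian_nonpos_at_max[OF S] max by blast
  then have "\<kappa> * (LINT y|lebesgue. g y) \<le> 0" using ineq frac(2)[of \<kappa>] by linarith
  then have "(LINT y|lebesgue. g y) \<le> 0" using \<kappa> by (simp add: mult_le_0_iff)
  moreover have g0: "0 \<le> g y" for y using max[of y] by (simp add: g_def)
  then have "0 \<le> (LINT y|lebesgue. g y)" by simp
  ultimately have "(LINT y|lebesgue. g y) = 0" by (rule order_antisym)
  then have "AE y in lebesgue. g y = 0"
    using integral_nonneg_eq_0_iff_AE[OF frac(1)] g0 by simp
  then show ?thesis
    by eventually_elim (use zero in \<open>auto simp: g_def\<close>)
qed

text \<open>Passes from vanishing on the region to its boundary, where the equality is not a consequence of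
  vanishing almost everywhere.\<close>

lemma upper_semicontinuous_on_closure_nonneg:
  assumes usc: "upper_semicontinuous_on (closure S) u" and zero: "\<forall>y\<in>S. u y = 0" and x: "x \<in> closure S"
  shows "0 \<le> u x"
proof (rule ccontr)
  assume "\<not> ?thesis"
  then have "\<forall>\<^sub>F y in at x within closure S. u y < u x + (- u x)"
    using usc x unfolding upper_semicontinuous_on_def by (metis neg_0_less_iff_less not_le)
  then obtain U where U: "open U" "x \<in> U" "\<forall>y\<in>U. y \<noteq> x \<longrightarrow> y \<in> closure S \<longrightarrow> u y < 0"
    by (auto simp: eventually_at_topological)
  then obtain y where "y \<in> S" "y \<in> U"
    using x open_Int_closure_eq_empty[of U S] by blast
  then show False using U(3) zero \<open>\<not> 0 \<le> u x\<close> closure_subset by (metis less_irrefl subsetD order_refl)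
qed

theorem theorem1p1:
  fixes s \<kappa> :: real
  assumes "0 < s" and "s < 1" and "0 < \<kappa>"
  shows "\<exists>C>0. \<forall>(k :: 'n::finite) (\<Omega> :: (real ^ 'n) set) (w :: real ^ 'n \<Rightarrow> real) (c :: real ^ 'n \<Rightarrow> real).
     open \<Omega> \<longrightarrow> bounded \<Omega> \<longrightarrow>
     w \<in> L2s_space s \<longrightarrow> C2_on \<Omega> w \<longrightarrow> upper_semicontinuous_on (closure \<Omega>) w \<longrightarrow>
     (\<forall>x\<in>\<Omega>. fractional_laplacian \<kappa> s w x - laplacian w x + c x * w x \<le> 0) \<longrightarrow>
     (\<forall>x\<in>-\<Omega>. w x \<le> 0) \<longrightarrow>
     bdd_below (c ` \<Omega>) \<longrightarrow>
     width k \<Omega> * \<bar>INF x\<in>\<Omega>. c x\<bar> powr (1 / (2 * s)) \<le> C \<longrightarrow>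
     (\<forall>x\<in>\<Omega>. w x \<le> 0) \<and>
     ((\<forall>x\<in>\<Omega>. w x < 0) \<or>
      (\<forall>x\<in>closure \<Omega>. w x = 0) \<and> (AE x in lebesgue. w x = 0))"
proof -
  define C where "C = (\<kappa> * unit_ball_vol CARD('n) / 4 powr (real CARD('n) + 2 * s)) powr (1 / (2 * s))"
  have "0 < \<kappa> * unit_ball_vol CARD('n) / 4 powr (real CARD('n) + 2 * s)" using assms(3) by simp
  then have C: "0 < C" unfolding C_def powr_gt_zero by (metis less_irrefl)
  show ?thesis
  \<comment> \<open>\<open>C\<close> is the threshold below which narrowness is contradictory; half of it turns the
    non-strict hypothesis into a strict one.\<close>
  proof (intro exI[of _ "C / 2"] conjI[of "0 < C / 2"] allI impI)
    show "0 < C / 2" using C by simp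
    fix k :: 'n and \<Omega> :: "(real ^ 'n) set" and w c :: "real ^ 'n \<Rightarrow> real"
    assume \<Omega>: "open \<Omega>" "bounded \<Omega>" and w: "w \<in> L2s_space s" and C2: "C2_on \<Omega> w"
      and usc: "upper_semicontinuous_on (closure \<Omega>) w"
      and ineq: "\<forall>x\<in>\<Omega>. fractional_laplacian \<kappa> s w x - laplacian w x + c x * w x \<le> 0"
      and outside: "\<forall>x\<in>-\<Omega>. w x \<le> 0" and bdd: "bdd_below (c ` \<Omega>)"
      and narrow: "width k \<Omega> * \<bar>INF x\<in>\<Omega>. c x\<bar> powr (1 / (2 * s)) \<le> C / 2"
    have "width k \<Omega> * \<bar>INF x\<in>\<Omega>. c x\<bar> powr (1 / (2 * s)) < C" using narrow C by linarith
    then have inside: "\<forall>x\<in>\<Omega>. w x \<le> 0"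
      unfolding C_def by (rule maximum_principle_narrow[OF assms \<Omega>(1) C2 \<Omega>(2) w usc ineq outside bdd])
    then have nonpos: "w x \<le> 0" for x using outside by (cases "x \<in> \<Omega>") auto
    have "(\<forall>x\<in>closure \<Omega>. w x = 0) \<and> (AE x in lebesgue. w x = 0)" if not_negative: "\<not> (\<forall>x\<in>\<Omega>. w x < 0)"
    proof -
      obtain x\<^sub>0 where x0: "x\<^sub>0 \<in> \<Omega>" "\<not> w x\<^sub>0 < 0" using not_negative by blast
      then have zero: "w x\<^sub>0 = 0" using nonpos[of x\<^sub>0] by simp
      have "fractional_laplacian \<kappa> s w x\<^sub>0 - laplacian w x\<^sub>0 \<le> 0" using ineq x0(1) zero by fastforce
      then have ae: "AE x in lebesgue. w x = 0"
        using strong_maximum_principle[OF assms \<Omega>(1) C2 x0(1) w _ nonpos zero] by blast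
      have "\<forall>x\<in>\<Omega>. w x = 0"
        using zero_of_AE_zero[OF \<Omega>(1) C2_on_imp_continuous_on[OF C2] ae] by blast
      then have "\<forall>x\<in>closure \<Omega>. w x = 0"
        using upper_semicontinuous_on_closure_nonneg[OF usc] nonpos by (simp add: order_antisym)
      then show ?thesis using ae by blast
    qed
    then show "(\<forall>x\<in>\<Omega>. w x \<le> 0) \<and> ((\<forall>x\<in>\<Omega>. w x < 0) \<or>
      (\<forall>x\<in>closure \<Omega>. w x = 0) \<and> (AE x in lebesgue. w x = 0))" using inside by blast
  qed
qed

end
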